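(* Let $K,K^*\subset\mathbb{R}^2$ be compact bodies. Let $\mu_1,\mu_2,\mu_1^*,\mu_2^*$ be $\sigma$-finite measures on $(\mathbb{R},\mathcal{B}(\mathbb{R}))$ that are absolutely continuous with respect to the Lebesgue measure, with Radon-Nikodym derivatives $f_1,f_2,f_1^*,f_2^*$, respectively. Let $\mu:=\mu_1\times\mu_2$ and $\mu^*:=\mu_1^*\times\mu_2^*$ be the product measures on $(\mathbb{R}^2,\mathcal{B}(\mathbb{R}^2))$, and assume that $\mu$ is supported by $K$ and $\mu^*$ is supported by $K^*$, and that $\mu(K)<\infty$ and $\mu^*(K^* )<\infty$. Suppose that for all $x,y\in\mathbb{R}$, $$\mu(\{(\alpha,\beta)\in K:\alpha=x\})=\mu(\{(\alpha,\beta)\in K:\beta=y\})=0$$ and $$\mu^*(\{(\alpha,\beta)\in K^*:\alpha=x\})=\mu^*(\{(\alpha,\beta)\in K^*:\beta=y\})=0.$$ Then $F_{K,\mu}=F_{K^*,\mu^*}$ (as functions on $\mathbb{R}^2$) if and only if $f_2(y)X_{K,\mu}(y)=f_2^*(y)X_{K^*,\mu^*}(y)$ for Lebesgue almost every $y\in\mathbb{R}$ and $f_1(x)Y_{K,\mu}(x)=f_1^*(x)Y_{K^*,\mu^*}(x)$ for Lebesgue almost every $x\in\mathbb{R}$.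
   Context: A compact body in $\mathbb{R}^2$ is a non-empty compact set that coincides with the closure of its interior. $\mathcal{B}(\mathbb{R}^d)$ is the Borel $\sigma$-algebra. A measure $\mu$ on $\mathbb{R}^2$ is supported by $K$ if $\mu(\mathbb{R}^2\setminus K)=0$. For a compact body $K$ and a measure $\mu$ with $\mu(K)<\infty$, the generalized conic function is $$F_{K,\mu}(x,y):=\int_K\big(|x-\alpha|+|y-\beta|\big)\,\mu(d\alpha,d\beta),\qquad (x,y)\in\mathbb{R}^2.$$ For a product $\mu=\mu_1\times\mu_2$ of $\sigma$-finite measures on $\mathbb{R}$ and $S\in\mathcal{B}(\mathbb{R}^2)$, the generalized $X$-ray functions of $S$ with respect to $\mu$ in the coordinate directions are $$X_{S,\mu}(y):=\mu_1(\{x\in\mathbb{R}:(x,y)\in S\}),\quad y\in\mathbb{R},\qquad Y_{S,\mu}(x):=\mu_2(\{y\in\mathbb{R}:(x,y)\in S\}),\quad x\in\mathbb{R}.$$ The usual measure-theoretic convention $0\cdot\infty=0$ is used in products. *)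

theory Defs
  imports "HOL-Analysis.Analysis"
begin

definition compact_body :: "(real \<times> real) set \<Rightarrow> bool" where
  "compact_body K \<longleftrightarrow> K \<noteq> {} \<and> compact K \<and> K = closure (interior K)"

definition supported_by :: "(real \<times> real) measure \<Rightarrow> (real \<times> real) set \<Rightarrow> bool" where
  "supported_by \<mu> K \<longleftrightarrow> emeasure \<mu> (UNIV - K) = 0"

(* f is some version of dN/dM; the library constant RN_deriv is one fixed (chosen) version. *)
definition is_RN_derivative :: "'a measure \<Rightarrow> 'a measure \<Rightarrow> ('a \<Rightarrow> ennreal) \<Rightarrow> bool" where
  "is_RN_derivative M N f \<longleftrightarrow> f \<in> borel_measurable M \<and> density M f = N"

(* For compact K with \<mu>(K) finite the integrand is bounded and Borel on K, so the Bochner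
   integral is a genuine one and not the default value 0. *)
definition generalized_conic ::
    "(real \<times> real) set \<Rightarrow> (real \<times> real) measure \<Rightarrow> real \<times> real \<Rightarrow> real" where
  "generalized_conic K \<mu> = (\<lambda>(x, y). LINT p:K|\<mu>. (\<bar>x - fst p\<bar> + \<bar>y - snd p\<bar>))"

(* The X-ray functions of S with respect to a product \<mu>1 \<times> \<mu>2 depend on the chosen factors, not
   only on the product measure, so they take the relevant factor as argument. Their values lie in
   ennreal, where 0 * \<infinity> = 0. *)
definition X_ray :: "(real \<times> real) set \<Rightarrow> real measure \<Rightarrow> real \<Rightarrow> ennreal" where
  "X_ray S \<mu>1 y = emeasure \<mu>1 {x. (x, y) \<in> S}"

definition Y_ray :: "(real \<times> real) set \<Rightarrow> real measure \<Rightarrow> real \<Rightarrow> ennreal" where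
  "Y_ray S \<mu>2 x = emeasure \<mu>2 {y. (x, y) \<in> S}"

end

theory Submission
  imports Defs "HOL-Probability.Distribution_Functions"
begin

text \<open>
  The function \<open>F\<close> sees \<open>\<mu>\<close> only through its two marginals \<open>m\<^sub>1\<close>, \<open>m\<^sub>2\<close>, and it is the sum of their
  one-dimensional potentials: \<open>F (x, y) = (\<integral>\<bar>x - a\<bar> dm\<^sub>1) + (\<integral>\<bar>y - b\<bar> dm\<^sub>2)\<close>. By Fubini and the
  Radon-Nikodym derivatives, \<open>m\<^sub>1\<close> has the Lebesgue density \<open>f\<^sub>1 Y\<close> and \<open>m\<^sub>2\<close> has the density \<open>f\<^sub>2 X\<close>.
  As densities are unique up to null sets, the theorem says that \<open>F\<close> and the pair of marginals
  determine each other. One direction is the displayed formula.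

  For the other, fix one of the two arguments: \<open>F\<close> determines the potential of each marginal up to an additive
  constant, and such a potential determines its measure: its right derivative at \<open>x\<close> is
  \<open>2 m (-\<infinity>, x] - m (\<real>)\<close>, whose limit at \<open>-\<infinity>\<close> is \<open>-m (\<real>)\<close>. So the total mass is known, hence the
  distribution function, hence \<open>m\<close>.
\<close>

section \<open>One-dimensional potentials\<close>

lemma integrable_abs_diff:
  fixes M :: "real measure"
  assumes "finite_borel_measure M" and "integrable M (\<lambda>a. a)"
  shows "integrable M (\<lambda>a. \<bar>x - a\<bar>)"
proof -
  interpret finite_borel_measure M by fact
  show ?thesis using assms(2) by (intro integrable_abs Bochner_Integration.integrable_diff) auto
qed

text \<open>The difference quotients of \<open>\<bar>x - a\<bar>\<close> are bounded by 1 and converge to \<open>1\<close> for \<open>a \<le> x\<close> and to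
  \<open>-1\<close> for \<open>a > x\<close>, so the limit may be taken under the integral. At an atom \<open>a = x\<close> the quotient from
  the right is 1; this is why a right-sided limit gives the right-continuous \<open>cdf\<close> exactly.\<close>

lemma right_derivative_potential:
  fixes M :: "real measure"
  assumes fbm: "finite_borel_measure M" and int: "integrable M (\<lambda>a. a)"
  shows "(\<lambda>n. real (Suc n) * ((LINT a|M. \<bar>x + 1 / real (Suc n) - a\<bar>) - (LINT a|M. \<bar>x - a\<bar>)))
    \<longlonglongrightarrow> 2 * cdf M x - measure M UNIV"
proof -
  interpret finite_borel_measure M by fact
  define q where "q n a = real (Suc n) * (\<bar>x + 1 / real (Suc n) - a\<bar> - \<bar>x - a\<bar>)" for n a
  define s where "s a = 2 * indicator {..x} a - (1::real)" for a
  have quotient: "real (Suc n) * ((LINT a|M. \<bar>x + 1 / real (Suc n) - a\<bar>) - (LINT a|M. \<bar>x - a\<bar>))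
      = (LINT a|M. q n a)" for n
    unfolding q_def using integrable_abs_diff[OF fbm int] by simp
  have lim: "(\<lambda>n. q n a) \<longlonglongrightarrow> s a" for a
  proof (cases "a \<le> x")
    case True
    have "\<bar>x + 1 / real (Suc n) - a\<bar> - \<bar>x - a\<bar> = 1 / real (Suc n)" for n
    proof -
      have "0 \<le> 1 / real (Suc n)" by simp
      with True show ?thesis by linarith
    qed
    then have "q n a = 1" for n by (simp add: q_def)
    with True show ?thesis by (simp add: s_def)
  next
    case False
    have "(\<lambda>n. 1 / real (Suc n)) \<longlonglongrightarrow> 0"
      by (rule LIMSEQ_Suc[OF lim_1_over_n])
    with False have "eventually (\<lambda>n. 1 / real (Suc n) < a - x) sequentially"
      by (intro order_tendstoD(2)) auto
    then have "eventually (\<lambda>n. q n a = s a) sequentially"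
    proof eventually_elim
      case (elim n)
      with False have "\<bar>x + 1 / real (Suc n) - a\<bar> - \<bar>x - a\<bar> = - (1 / real (Suc n))"
        by (simp only: abs_if) auto
      with False show ?case by (simp add: q_def s_def)
    qed
    then show ?thesis by (rule tendsto_eventually)
  qed
  have bound: "\<bar>q n a\<bar> \<le> 1" for n a
  proof -
    have "\<bar>\<bar>x + 1 / real (Suc n) - a\<bar> - \<bar>x - a\<bar>\<bar> \<le> 1 / real (Suc n)"
      using abs_triangle_ineq3[of "x + 1 / real (Suc n) - a" "x - a"] by simp
    then have "real (Suc n) * \<bar>\<bar>x + 1 / real (Suc n) - a\<bar> - \<bar>x - a\<bar>\<bar> \<le> real (Suc n) * (1 / real (Suc n))"
      by (intro mult_left_mono) auto
    then show ?thesis by (simp add: q_def abs_mult)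
  qed
  note [measurable_cong] = M_is_borel
  have [measurable]: "s \<in> borel_measurable M" "q n \<in> borel_measurable M" for n
    unfolding s_def q_def by measurable
  have "(\<lambda>n. LINT a|M. q n a) \<longlonglongrightarrow> (LINT a|M. s a)"
    using lim bound by (intro integral_dominated_convergence[where w = "\<lambda>_. 1"]) auto
  moreover have "(LINT a|M. s a) = 2 * cdf M x - measure M UNIV"
  proof -
    have "integrable M (indicator {..x} :: real \<Rightarrow> real)"
      by (simp add: integrable_indicator_iff M_is_borel less_top[symmetric])
    then show ?thesis
      unfolding s_def by (subst Bochner_Integration.integral_diff)
        (auto simp: cdf_def sets_eq_imp_space_eq[OF M_is_borel])
  qed
  ultimately show ?thesis by (simp only: quotient)
qed

text \<open>Equal right derivatives make the two distribution functions differ by half the difference of the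
  total masses; since both tend to 0 at \<open>-\<infinity>\<close>, the difference is 0.\<close>

lemma potential_determines_measure:
  fixes M N :: "real measure"
  assumes M: "finite_borel_measure M" "integrable M (\<lambda>a. a)"
    and N: "finite_borel_measure N" "integrable N (\<lambda>a. a)"
    and eq: "\<And>x. (LINT a|M. \<bar>x - a\<bar>) = (LINT a|N. \<bar>x - a\<bar>) + c"
  shows "M = N"
proof -
  have "2 * cdf M x - measure M UNIV = 2 * cdf N x - measure N UNIV" for x
    using right_derivative_potential[OF M, of x] right_derivative_potential[OF N, of x]
    by (intro LIMSEQ_unique) (simp_all add: eq)
  then have cdf_eq: "cdf M x = cdf N x + (measure M UNIV - measure N UNIV) / 2" for x
    by (simp add: field_simps)
  have "(cdf M \<longlongrightarrow> 0 + (measure M UNIV - measure N UNIV) / 2) at_bot"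
    unfolding cdf_eq by (intro tendsto_intros finite_borel_measure.cdf_lim_at_bot N)
  from tendsto_unique[OF _ this finite_borel_measure.cdf_lim_at_bot[OF M(1)]]
  have "cdf M = cdf N" by (auto simp: cdf_eq fun_eq_iff)
  with M(1) N(1) show ?thesis by (rule cdf_unique')
qed

section \<open>The conic function and the marginals\<close>

text \<open>Off \<open>K\<close> there is no mass, so the integral over \<open>K\<close> is one over the whole plane and can be pushed
  forward along the two projections. Compactness of \<open>K\<close> bounds the coordinates almost everywhere,
  which gives the finite first moments.\<close>

lemma marginals_of_compactly_supported:
  fixes \<mu> :: "(real \<times> real) measure"
  assumes sets: "sets \<mu> = sets borel" and K: "compact K"
    and supp: "supported_by \<mu> K" and fin: "emeasure \<mu> K < \<infinity>"
  shows "finite_borel_measure (distr \<mu> borel fst)" and "finite_borel_measure (distr \<mu> borel snd)"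
    and "integrable (distr \<mu> borel fst) (\<lambda>a. a)" and "integrable (distr \<mu> borel snd) (\<lambda>a. a)"
    and "generalized_conic K \<mu> (x, y) =
      (LINT a|distr \<mu> borel fst. \<bar>x - a\<bar>) + (LINT b|distr \<mu> borel snd. \<bar>y - b\<bar>)"
proof -
  note [measurable_cong] = sets
  have space: "space \<mu> = UNIV"
    using sets_eq_imp_space_eq[OF sets] by simp
  have Kb: "K \<in> sets borel" using K by (simp add: borel_compact)
  have null: "UNIV - K \<in> null_sets \<mu>"
    using supp Kb by (auto simp: supported_by_def null_sets_def sets)
  have AE_K: "AE p in \<mu>. p \<in> K"
    using null by (rule AE_I') (auto simp: space)
  have "emeasure \<mu> (space \<mu>) = emeasure \<mu> K"
    using AE_K Kb by (intro emeasure_eq_AE) (auto simp: space sets)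
  then interpret finite_measure \<mu> using fin by (intro finite_measureI) auto
  have fst_m[measurable]: "fst \<in> borel_measurable \<mu>" and snd_m[measurable]: "snd \<in> borel_measurable \<mu>"
    by (auto intro!: borel_measurable_continuous_onI continuous_intros
        simp: measurable_cong_sets[OF sets refl])
  show fbm: "finite_borel_measure (distr \<mu> borel fst)" "finite_borel_measure (distr \<mu> borel snd)"
    by (auto simp: finite_borel_measure_def finite_borel_measure_axioms_def intro: finite_measure_distr)
  obtain B where B: "\<And>p. p \<in> K \<Longrightarrow> norm p \<le> B"
    using compact_imp_bounded[OF K] by (auto simp: bounded_iff)
  have "integrable \<mu> fst"
    using AE_K B norm_fst_le order_trans by (intro integrable_const_bound[where B = B]) (fastforce+)
  then show int1: "integrable (distr \<mu> borel fst) (\<lambda>a. a)"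
    by (simp add: integrable_distr_eq)
  have "integrable \<mu> snd"
    using AE_K B norm_snd_le order_trans by (intro integrable_const_bound[where B = B]) (fastforce+)
  then show int2: "integrable (distr \<mu> borel snd) (\<lambda>a. a)"
    by (simp add: integrable_distr_eq)
  have int1': "integrable \<mu> (\<lambda>p. \<bar>x - fst p\<bar>)"
    using integrable_abs_diff[OF fbm(1) int1, of x] by (simp add: integrable_distr_eq)
  have int2': "integrable \<mu> (\<lambda>p. \<bar>y - snd p\<bar>)"
    using integrable_abs_diff[OF fbm(2) int2, of y] by (simp add: integrable_distr_eq)
  have "generalized_conic K \<mu> (x, y) = (LINT p|\<mu>. \<bar>x - fst p\<bar> + \<bar>y - snd p\<bar>)"
    using AE_K Kb unfolding generalized_conic_def set_lebesgue_integral_def prod.case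
    by (intro integral_cong_AE) (auto simp: sets)
  also have "\<dots> = (LINT p|\<mu>. \<bar>x - fst p\<bar>) + (LINT p|\<mu>. \<bar>y - snd p\<bar>)"
    by (rule Bochner_Integration.integral_add[OF int1' int2'])
  finally show "generalized_conic K \<mu> (x, y) =
      (LINT a|distr \<mu> borel fst. \<bar>x - a\<bar>) + (LINT b|distr \<mu> borel snd. \<bar>y - b\<bar>)"
    by (simp add: integral_distr)
qed

text \<open>Setting \<open>y = 0\<close> (or \<open>x = 0\<close>) turns equality of the conic functions into equality of the
  potentials of the first (or second) marginals up to the constant that the other marginals leave.\<close>

lemma conic_eq_iff_marginals_eq:
  fixes \<mu> \<nu> :: "(real \<times> real) measure"
  assumes \<mu>: "sets \<mu> = sets borel" "compact K" "supported_by \<mu> K" "emeasure \<mu> K < \<infinity>"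
    and \<nu>: "sets \<nu> = sets borel" "compact L" "supported_by \<nu> L" "emeasure \<nu> L < \<infinity>"
  shows "generalized_conic K \<mu> = generalized_conic L \<nu> \<longleftrightarrow>
    distr \<mu> borel fst = distr \<nu> borel fst \<and> distr \<mu> borel snd = distr \<nu> borel snd"
proof
  note m = marginals_of_compactly_supported[OF \<mu>] and n = marginals_of_compactly_supported[OF \<nu>]
  assume F: "generalized_conic K \<mu> = generalized_conic L \<nu>"
  have sum: "(LINT a|distr \<mu> borel fst. \<bar>x - a\<bar>) + (LINT b|distr \<mu> borel snd. \<bar>y - b\<bar>)
      = (LINT a|distr \<nu> borel fst. \<bar>x - a\<bar>) + (LINT b|distr \<nu> borel snd. \<bar>y - b\<bar>)" for x y
    using fun_cong[OF F, of "(x, y)"] m(5)[of x y] n(5)[of x y] by simp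
  have "distr \<mu> borel fst = distr \<nu> borel fst"
  proof (rule potential_determines_measure[OF m(1,3) n(1,3)])
    show "(LINT a|distr \<mu> borel fst. \<bar>x - a\<bar>) = (LINT a|distr \<nu> borel fst. \<bar>x - a\<bar>)
        + ((LINT b|distr \<nu> borel snd. \<bar>0 - b\<bar>) - (LINT b|distr \<mu> borel snd. \<bar>0 - b\<bar>))" for x
      using sum[of x 0] by linarith
  qed
  moreover have "distr \<mu> borel snd = distr \<nu> borel snd"
  proof (rule potential_determines_measure[OF m(2,4) n(2,4)])
    show "(LINT b|distr \<mu> borel snd. \<bar>y - b\<bar>) = (LINT b|distr \<nu> borel snd. \<bar>y - b\<bar>)
        + ((LINT a|distr \<nu> borel fst. \<bar>0 - a\<bar>) - (LINT a|distr \<mu> borel fst. \<bar>0 - a\<bar>))" for y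
      using sum[of 0 y] by linarith
  qed
  ultimately show "distr \<mu> borel fst = distr \<nu> borel fst \<and> distr \<mu> borel snd = distr \<nu> borel snd" ..
next
  assume "distr \<mu> borel fst = distr \<nu> borel fst \<and> distr \<mu> borel snd = distr \<nu> borel snd"
  then show "generalized_conic K \<mu> = generalized_conic L \<nu>"
    by (auto simp: fun_eq_iff marginals_of_compactly_supported(5)[OF \<mu>]
        marginals_of_compactly_supported(5)[OF \<nu>])
qed

section \<open>The densities of the marginals\<close>

text \<open>Since \<open>\<mu>\<close> vanishes off \<open>K\<close>, the strip over a Borel set \<open>A\<close> has the same measure as its part in
  \<open>K\<close>; Cavalieri's principle writes the latter as the integral of the X-ray function over \<open>A\<close>.\<close>

lemma marginals_eq_density:
  fixes \<mu>1 \<mu>2 :: "real measure"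
  assumes sets: "sets \<mu>1 = sets borel" "sets \<mu>2 = sets borel"
    and sf: "sigma_finite_measure \<mu>1" "sigma_finite_measure \<mu>2"
    and rn: "is_RN_derivative lborel \<mu>1 f1" "is_RN_derivative lborel \<mu>2 f2"
    and K: "compact K" and supp: "supported_by (\<mu>1 \<Otimes>\<^sub>M \<mu>2) K"
  shows "(\<lambda>x. f1 x * Y_ray K \<mu>2 x) \<in> borel_measurable lborel"
    and "(\<lambda>y. f2 y * X_ray K \<mu>1 y) \<in> borel_measurable lborel"
    and "distr (\<mu>1 \<Otimes>\<^sub>M \<mu>2) borel fst = density lborel (\<lambda>x. f1 x * Y_ray K \<mu>2 x)"
    and "distr (\<mu>1 \<Otimes>\<^sub>M \<mu>2) borel snd = density lborel (\<lambda>y. f2 y * X_ray K \<mu>1 y)"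
proof -
  interpret s1: sigma_finite_measure \<mu>1 by fact
  interpret s2: sigma_finite_measure \<mu>2 by fact
  interpret pair_sigma_finite \<mu>1 \<mu>2 ..
  note [measurable_cong] = sets
  let ?\<mu> = "\<mu>1 \<Otimes>\<^sub>M \<mu>2"
  have setsP: "sets ?\<mu> = sets borel"
    using sets_pair_measure_cong[OF sets] by (simp only: borel_prod)
  have Kb: "K \<in> sets ?\<mu>" using K by (simp add: borel_compact setsP)
  have space1: "space \<mu>1 = UNIV" and space2: "space \<mu>2 = UNIV"
    using sets[THEN sets_eq_imp_space_eq] by auto
  have AE_K: "AE p in ?\<mu>. p \<in> K"
    using supp Kb by (intro AE_I[where N = "UNIV - K"]) (auto simp: supported_by_def setsP)
  have f[measurable]: "f1 \<in> borel_measurable borel" "f2 \<in> borel_measurable borel"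
    and d: "\<mu>1 = density lborel f1" "\<mu>2 = density lborel f2"
    using rn by (auto simp: is_RN_derivative_def)
  have Y: "Y_ray K \<mu>2 = (\<lambda>x. emeasure \<mu>2 (Pair x -` K))"
    by (auto simp: Y_ray_def vimage_def)
  have X: "X_ray K \<mu>1 = (\<lambda>y. emeasure \<mu>1 ((\<lambda>x. (x, y)) -` K))"
    by (auto simp: X_ray_def vimage_def)
  have Ym[measurable]: "Y_ray K \<mu>2 \<in> borel_measurable borel"
    using s2.measurable_emeasure_Pair[OF Kb] by (simp add: Y measurable_cong_sets[OF sets(1) refl])
  have Xm[measurable]: "X_ray K \<mu>1 \<in> borel_measurable borel"
    using measurable_emeasure_Pair2[OF Kb] by (simp add: X measurable_cong_sets[OF sets(2) refl])
  show "(\<lambda>x. f1 x * Y_ray K \<mu>2 x) \<in> borel_measurable lborel"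
    and "(\<lambda>y. f2 y * X_ray K \<mu>1 y) \<in> borel_measurable lborel" by measurable
  have strip1: "emeasure ?\<mu> (fst -` A \<inter> space ?\<mu>) = (\<integral>\<^sup>+x. f1 x * Y_ray K \<mu>2 x * indicator A x \<partial>lborel)"
    if [measurable]: "A \<in> sets borel" for A
  proof -
    have A: "fst -` A \<inter> space ?\<mu> \<in> sets ?\<mu>" by measurable
    have "emeasure ?\<mu> (fst -` A \<inter> space ?\<mu>) = emeasure ?\<mu> (fst -` A \<inter> space ?\<mu> \<inter> K)"
      using AE_K A Kb by (intro emeasure_eq_AE) auto
    also have "\<dots> = (\<integral>\<^sup>+x. emeasure \<mu>2 (Pair x -` (fst -` A \<inter> space ?\<mu> \<inter> K)) \<partial>\<mu>1)"
      using A Kb by (intro s2.emeasure_pair_measure_alt) auto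
    also have "\<dots> = (\<integral>\<^sup>+x. Y_ray K \<mu>2 x * indicator A x \<partial>\<mu>1)"
      by (intro nn_integral_cong)
        (auto simp: Y space_pair_measure space1 space2 vimage_def split: split_indicator)
    also have "\<dots> = (\<integral>\<^sup>+x. f1 x * Y_ray K \<mu>2 x * indicator A x \<partial>lborel)"
      unfolding d(1) by (subst nn_integral_density) (auto simp: ac_simps)
    finally show ?thesis .
  qed
  have strip2: "emeasure ?\<mu> (snd -` A \<inter> space ?\<mu>) = (\<integral>\<^sup>+y. f2 y * X_ray K \<mu>1 y * indicator A y \<partial>lborel)"
    if [measurable]: "A \<in> sets borel" for A
  proof -
    have A: "snd -` A \<inter> space ?\<mu> \<in> sets ?\<mu>" by measurable
    have "emeasure ?\<mu> (snd -` A \<inter> space ?\<mu>) = emeasure ?\<mu> (snd -` A \<inter> space ?\<mu> \<inter> K)"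
      using AE_K A Kb by (intro emeasure_eq_AE) auto
    also have "\<dots> = (\<integral>\<^sup>+y. emeasure \<mu>1 ((\<lambda>x. (x, y)) -` (snd -` A \<inter> space ?\<mu> \<inter> K)) \<partial>\<mu>2)"
      using A Kb by (intro emeasure_pair_measure_alt2) auto
    also have "\<dots> = (\<integral>\<^sup>+y. X_ray K \<mu>1 y * indicator A y \<partial>\<mu>2)"
      by (intro nn_integral_cong)
        (auto simp: X space_pair_measure space1 space2 vimage_def split: split_indicator)
    also have "\<dots> = (\<integral>\<^sup>+y. f2 y * X_ray K \<mu>1 y * indicator A y \<partial>lborel)"
      unfolding d(2) by (subst nn_integral_density) (auto simp: ac_simps)
    finally show ?thesis .
  qed
  show "distr ?\<mu> borel fst = density lborel (\<lambda>x. f1 x * Y_ray K \<mu>2 x)"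
    using strip1 by (intro measure_eqI) (auto simp: emeasure_distr emeasure_density)
  show "distr ?\<mu> borel snd = density lborel (\<lambda>y. f2 y * X_ray K \<mu>1 y)"
    using strip2 by (intro measure_eqI) (auto simp: emeasure_distr emeasure_density)
qed

section \<open>Conic functions and X-rays\<close>

theorem theorem2p3:
  fixes K K' :: "(real \<times> real) set"
    and \<mu>1 \<mu>2 \<mu>1' \<mu>2' :: "real measure"
    and \<mu> \<mu>' :: "(real \<times> real) measure"
    and f1 f2 f1' f2' :: "real \<Rightarrow> ennreal"
  assumes "compact_body K" and "compact_body K'"
    and "sets \<mu>1 = sets borel" and "sets \<mu>2 = sets borel"
    and "sets \<mu>1' = sets borel" and "sets \<mu>2' = sets borel"
    and "sigma_finite_measure \<mu>1" and "sigma_finite_measure \<mu>2"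
    and "sigma_finite_measure \<mu>1'" and "sigma_finite_measure \<mu>2'"
    and "absolutely_continuous lborel \<mu>1" and "absolutely_continuous lborel \<mu>2"
    and "absolutely_continuous lborel \<mu>1'" and "absolutely_continuous lborel \<mu>2'"
    and "is_RN_derivative lborel \<mu>1 f1" and "is_RN_derivative lborel \<mu>2 f2"
    and "is_RN_derivative lborel \<mu>1' f1'" and "is_RN_derivative lborel \<mu>2' f2'"
    and "\<mu> = \<mu>1 \<Otimes>\<^sub>M \<mu>2" and "\<mu>' = \<mu>1' \<Otimes>\<^sub>M \<mu>2'"
    and "supported_by \<mu> K" and "supported_by \<mu>' K'"
    and "emeasure \<mu> K < \<infinity>" and "emeasure \<mu>' K' < \<infinity>"
    and "\<forall>x y. emeasure \<mu> {(\<alpha>, \<beta>) \<in> K. \<alpha> = x} = 0 \<and> emeasure \<mu> {(\<alpha>, \<beta>) \<in> K. \<beta> = y} = 0"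
    and "\<forall>x y. emeasure \<mu>' {(\<alpha>, \<beta>) \<in> K'. \<alpha> = x} = 0 \<and> emeasure \<mu>' {(\<alpha>, \<beta>) \<in> K'. \<beta> = y} = 0"
  shows "generalized_conic K \<mu> = generalized_conic K' \<mu>' \<longleftrightarrow>
    (AE y in lborel. f2 y * X_ray K \<mu>1 y = f2' y * X_ray K' \<mu>1' y) \<and>
    (AE x in lborel. f1 x * Y_ray K \<mu>2 x = f1' x * Y_ray K' \<mu>2' x)"
proof -
  have compact: "compact K" "compact K'"
    using assms(1,2) by (auto simp: compact_body_def)
  have sets: "sets \<mu> = sets borel" "sets \<mu>' = sets borel"
    using sets_pair_measure_cong[OF assms(3,4)] sets_pair_measure_cong[OF assms(5,6)]
    by (simp_all only: \<open>\<mu> = \<mu>1 \<Otimes>\<^sub>M \<mu>2\<close> \<open>\<mu>' = \<mu>1' \<Otimes>\<^sub>M \<mu>2'\<close> borel_prod)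
  note supp = \<open>supported_by \<mu> K\<close> \<open>supported_by \<mu>' K'\<close>
  note d = marginals_eq_density[OF assms(3,4,7,8,15,16) compact(1)
      supp(1)[unfolded \<open>\<mu> = \<mu>1 \<Otimes>\<^sub>M \<mu>2\<close>], folded \<open>\<mu> = \<mu>1 \<Otimes>\<^sub>M \<mu>2\<close>]
  note d' = marginals_eq_density[OF assms(5,6,9,10,17,18) compact(2)
      supp(2)[unfolded \<open>\<mu>' = \<mu>1' \<Otimes>\<^sub>M \<mu>2'\<close>], folded \<open>\<mu>' = \<mu>1' \<Otimes>\<^sub>M \<mu>2'\<close>]
  have "generalized_conic K \<mu> = generalized_conic K' \<mu>' \<longleftrightarrow>
      distr \<mu> borel fst = distr \<mu>' borel fst \<and> distr \<mu> borel snd = distr \<mu>' borel snd"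
    by (rule conic_eq_iff_marginals_eq[OF sets(1) compact(1) supp(1) \<open>emeasure \<mu> K < \<infinity>\<close>
          sets(2) compact(2) supp(2) \<open>emeasure \<mu>' K' < \<infinity>\<close>])
  also have "\<dots> \<longleftrightarrow> (AE x in lborel. f1 x * Y_ray K \<mu>2 x = f1' x * Y_ray K' \<mu>2' x) \<and>
      (AE y in lborel. f2 y * X_ray K \<mu>1 y = f2' y * X_ray K' \<mu>1' y)"
    unfolding d(3,4) d'(3,4)
      sigma_finite_measure.density_unique_iff[OF sigma_finite_lborel d(1) d'(1)] sigma_finite_measure.density_unique_iff[OF sigma_finite_lborel d(2) d'(2)] ..
  finally show ?thesis by blast
qed

end
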